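(* For all integers $a,b\ge 0$, $$H^{\star}(a,b)=-4\,\zeta\left(2a+1,\overline{2b+2}\right)-2\,\zeta\left(\overline{2a+2b+3}\right).$$
   Context: For positive integers $k_1,\dots,k_n$ with $k_n\ge 2$, $$\zeta^{\star}(k_1,\dots,k_n)=\sum_{1\le m_1\le\cdots\le m_n}\frac{1}{m_1^{k_1}\cdots m_n^{k_n}},$$ and $H^{\star}(a,b)=\zeta^{\star}(\underbrace{2,\dots,2}_{a},3,\underbrace{2,\dots,2}_{b})$. For positive integers $r,s,k$, $$\zeta(r,\overline{s})=\sum_{m=2}^{\infty}\frac{(-1)^m}{m^s}\sum_{j=1}^{m-1}\frac{1}{j^r},\qquad \zeta(\overline{k})=\sum_{m=1}^\infty\frac{(-1)^m}{m^k}.$$ *)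

theory Defs
  imports "HOL-Analysis.Analysis"
begin

text \<open>
  The summation indices \<open>1 \<le> m\<^sub>1 \<le> \<dots> \<le> m\<^sub>n\<close> are the entries of a sorted list.  The terms are
  nonnegative, so the unordered sum over all such lists is the nested sum.
\<close>
definition zeta_star :: "nat list \<Rightarrow> real" where
  "zeta_star ks =
     (\<Sum>\<^sub>\<infinity>ms\<in>{ms :: nat list. length ms = length ks \<and> sorted ms \<and> (\<forall>m\<in>set ms. 1 \<le> m)}.
        1 / (\<Prod>i<length ks. real (ms ! i) ^ (ks ! i)))"

definition H_star :: "nat \<Rightarrow> nat \<Rightarrow> real" where
  "H_star a b = zeta_star (replicate a 2 @ [3] @ replicate b 2)"

text \<open>
  The value \<open>\<zeta>(r, s)\<close> with a bar on \<open>s\<close>.  The series may converge only conditionally (for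
  \<open>s = 1\<close>), so it is an ordered sum; its index is shifted so that \<open>m + 2\<close> runs from 2.
\<close>
definition zeta_bar2 :: "nat \<Rightarrow> nat \<Rightarrow> real" where
  "zeta_bar2 r s =
     (\<Sum>m. (-1) ^ (m + 2) / real (m + 2) ^ s * (\<Sum>j = 1..m + 1. 1 / real j ^ r))"

text \<open>The value \<open>\<zeta>(k)\<close> with a bar on \<open>k\<close>; here \<open>m + 1\<close> runs from 1.\<close>
definition zeta_bar :: "nat \<Rightarrow> real" where
  "zeta_bar k = (\<Sum>m. (-1) ^ (m + 1) / real (m + 1) ^ k)"

end

theory Submission
  imports Defs "HOL-Real_Asymp.Real_Asymp"
begin

text \<open>
  Let \<open>c(N, l) = binom(N, l) / binom(N + l, l)\<close>.  If the sum truncated at \<open>M\<close> is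
  \<open>\<Sum>\<^sub>l c(M, l) g(l)\<close> for every \<open>M \<ge> 1\<close>, then appending an exponent 2 replaces
  \<open>g(l)\<close> by \<open>g(l) / l\<^sup>2\<close>, because \<open>c(N, l) - c(N - 1, l) = c(N, l) l\<^sup>2 / N\<^sup>2\<close>.
  Appending a 3 needs in addition an expansion of \<open>(1 / N) \<Sum>\<^sub>l c(N, l) g(l)\<close> in the same
  weights; summation by parts based on \<open>(N + l + 1) c(N, l + 1) = (N - l) c(N, l)\<close> gives
  \<open>\<Sum>\<^sub>l c(N, l) (P(l) - P(l - 1))\<close> with \<open>P(l) + P(l - 1) = g(l) / l\<close>.  The empty sum
  corresponds to \<open>g(l) = -2 (-1)\<^sup>l\<close>, so after \<open>a\<close> exponents 2 the solution is
  \<open>P(l) = -2 (-1)\<^sup>l \<Sum>\<^sub>j\<^sub>\<le>\<^sub>l 1 / j\<^bsup>2a+1\<^esup>\<close>.  As \<open>0 \<le> c(N, l) \<le> 1\<close> and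
  \<open>c(N, l) \<longlonglongrightarrow> 1\<close>, dominated convergence yields the identity in the limit.
\<close>

section \<open>Truncated sums\<close>

definition bounded_chains :: "nat \<Rightarrow> nat \<Rightarrow> nat list set" where
  "bounded_chains N n = {ms. length ms = n \<and> sorted ms \<and> set ms \<subseteq> {1..N}}"

definition zeta_star_upto :: "nat \<Rightarrow> nat list \<Rightarrow> real" where
  "zeta_star_upto N ks =
     (\<Sum>ms\<in>bounded_chains N (length ks). 1 / (\<Prod>i<length ks. real (ms ! i) ^ (ks ! i)))"

lemma finite_bounded_chains: "finite (bounded_chains N n)"
  by (rule finite_subset[OF _ finite_lists_length_eq[of "{1..N}" n]])
     (auto simp: bounded_chains_def)

lemma zeta_star_upto_Nil: "zeta_star_upto N [] = 1"
proof -
  have "bounded_chains N 0 = {[]}"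
    by (auto simp: bounded_chains_def)
  then show ?thesis
    by (simp add: zeta_star_upto_def)
qed

text \<open>The last entry of a sorted list is its maximum, so removing it leaves a chain bounded by
  it.\<close>

lemma zeta_star_upto_snoc:
  "zeta_star_upto N (ks @ [k]) = (\<Sum>M=1..N. zeta_star_upto M ks / real M ^ k)"
proof -
  let ?n = "length ks"
  let ?w = "\<lambda>ms. 1 / (\<Prod>i<?n. real (ms ! i) ^ (ks ! i))"
  have "(\<Sum>M=1..N. zeta_star_upto M ks / real M ^ k)
      = (\<Sum>M=1..N. \<Sum>ms\<in>bounded_chains M ?n. ?w ms / real M ^ k)"
    by (simp add: zeta_star_upto_def sum_divide_distrib)
  also have "\<dots> = (\<Sum>(M, ms)\<in>Sigma {1..N} (\<lambda>M. bounded_chains M ?n). ?w ms / real M ^ k)"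
    by (rule sum.Sigma) (auto simp: finite_bounded_chains)
  also have "\<dots> = (\<Sum>ms\<in>bounded_chains N (Suc ?n).
      1 / (\<Prod>i<Suc ?n. real (ms ! i) ^ ((ks @ [k]) ! i)))"
  proof (rule sum.reindex_bij_witness[where
        i = "\<lambda>ms. (last ms, butlast ms)" and j = "\<lambda>(M, ms). ms @ [M]"])
    fix p assume "p \<in> Sigma {1..N} (\<lambda>M. bounded_chains M ?n)"
    then obtain M ms where p: "p = (M, ms)" and M: "M \<in> {1..N}" and ms: "ms \<in> bounded_chains M ?n"
      by auto
    show "(last (case p of (M, ms) \<Rightarrow> ms @ [M]), butlast (case p of (M, ms) \<Rightarrow> ms @ [M])) = p"
      by (simp add: p)
    show "(case p of (M, ms) \<Rightarrow> ms @ [M]) \<in> bounded_chains N (Suc ?n)"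
      using M ms by (fastforce simp: p bounded_chains_def sorted_append)
    have "length ms = ?n"
      using ms by (simp add: bounded_chains_def)
    then show "1 / (\<Prod>i<Suc ?n. real ((case p of (M, ms) \<Rightarrow> ms @ [M]) ! i) ^ ((ks @ [k]) ! i))
        = (case p of (M, ms) \<Rightarrow> ?w ms / real M ^ k)"
      by (simp add: p nth_append)
  next
    fix ms assume "ms \<in> bounded_chains N (Suc ?n)"
    then obtain xs x where ms: "ms = xs @ [x]" and *: "xs @ [x] \<in> bounded_chains N (Suc ?n)"
      by (metis (mono_tags, lifting) bounded_chains_def length_Suc_conv_rev mem_Collect_eq)
    show "(case (last ms, butlast ms) of (M, ms) \<Rightarrow> ms @ [M]) = ms"
      by (simp add: ms)
    show "(last ms, butlast ms) \<in> Sigma {1..N} (\<lambda>M. bounded_chains M ?n)"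
      using * by (auto simp: ms bounded_chains_def sorted_append)
  qed
  finally show ?thesis
    by (simp add: zeta_star_upto_def)
qed

text \<open>By monotonicity of \<open>S\<close>, each finite subset of \<open>A\<close> lies in some
  \<open>S N\<close>. As the terms are nonnegative, its sum is at most \<open>L\<close>, and it
  exceeds any \<open>y < L\<close> once it contains a suitable \<open>S N\<close>.\<close>

lemma has_sum_exhaustion:
  fixes f :: "'a \<Rightarrow> real"
  assumes nonneg: "\<And>x. x \<in> A \<Longrightarrow> 0 \<le> f x"
    and fin: "\<And>N. finite (S N)"
    and mono: "incseq S"
    and un: "(\<Union>N. S N) = A"
    and lim: "(\<lambda>N. sum f (S N)) \<longlonglongrightarrow> L"
  shows "(f has_sum L) A"
  unfolding has_sum_def
proof (rule order_tendstoI)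
  fix y assume "y < L"
  then obtain N where N: "y < sum f (S N)"
    using order_tendstoD(1)[OF lim, of y] by (auto simp: eventually_sequentially)
  show "\<forall>\<^sub>F F in finite_subsets_at_top A. y < sum f F"
    unfolding eventually_finite_subsets_at_top
  proof (intro exI[of _ "S N"] conjI allI impI)
    show "finite (S N)" "S N \<subseteq> A"
      using fin un by auto
    fix F assume F: "finite F \<and> S N \<subseteq> F \<and> F \<subseteq> A"
    then have "sum f (S N) \<le> sum f F"
      by (intro sum_mono2) (auto intro: nonneg)
    with N show "y < sum f F" by simp
  qed
next
  have S_le: "sum f (S N) \<le> L" for N
  proof (rule incseq_le[OF _ lim])
    show "incseq (\<lambda>N. sum f (S N))"
    proof (rule monoI)
      fix m n :: nat assume "m \<le> n"
      with mono have "S m \<subseteq> S n" by (rule monoD)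
      moreover have "S n \<subseteq> A" using un by auto
      ultimately show "sum f (S m) \<le> sum f (S n)"
        using fin nonneg by (intro sum_mono2) auto
    qed
  qed
  fix y assume y: "L < y"
  show "\<forall>\<^sub>F F in finite_subsets_at_top A. sum f F < y"
  proof (rule eventually_finite_subsets_at_top_weakI)
    fix F assume F: "finite F" "F \<subseteq> A"
    have "\<exists>N. F \<subseteq> S N"
      using F
    proof (induction F rule: finite_induct)
      case (insert x F)
      then obtain N where N: "F \<subseteq> S N" by auto
      from insert un obtain M where M: "x \<in> S M" by auto
      have "S N \<subseteq> S (max M N)" "S M \<subseteq> S (max M N)"
        by (auto intro!: monoD[OF mono])
      with M N show ?case by (intro exI[of _ "max M N"]) auto
    qed simp
    then obtain N where N: "F \<subseteq> S N" ..
    have "S N \<subseteq> A" using un by auto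
    then have "sum f F \<le> sum f (S N)"
      using N fin nonneg by (intro sum_mono2) auto
    also have "\<dots> \<le> L" by (rule S_le)
    finally show "sum f F < y" using y by simp
  qed
qed

lemma zeta_star_eq_limit:
  assumes "(\<lambda>N. zeta_star_upto N ks) \<longlonglongrightarrow> L"
  shows "zeta_star ks = L"
  unfolding zeta_star_def
proof (rule infsumI, rule has_sum_exhaustion[where S = "\<lambda>N. bounded_chains N (length ks)"])
  show "incseq (\<lambda>N. bounded_chains N (length ks))"
    by (intro monoI) (auto simp: bounded_chains_def)
  show "(\<Union>N. bounded_chains N (length ks))
      = {ms. length ms = length ks \<and> sorted ms \<and> (\<forall>m\<in>set ms. 1 \<le> m)}"
  proof (intro equalityI subsetI)
    fix ms :: "nat list"
    assume "ms \<in> {ms. length ms = length ks \<and> sorted ms \<and> (\<forall>m\<in>set ms. 1 \<le> m)}"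
    \<comment> \<open>For the empty list \<open>Max\<close> is unspecified, but the bound on the
      entries is then vacuous.\<close>
    then have "ms \<in> bounded_chains (Max (set ms)) (length ks)"
      by (auto simp: bounded_chains_def Suc_le_eq)
    then show "ms \<in> (\<Union>N. bounded_chains N (length ks))" by blast
  qed (auto simp: bounded_chains_def)
qed (use assms in \<open>auto simp: finite_bounded_chains zeta_star_upto_def intro!: prod_nonneg\<close>)

section \<open>The binomial weights\<close>

text \<open>
  The weight is \<open>binom(N, l) / binom(N + l, l)\<close>; over the reals the product vanishes by itself
  for \<open>l > N\<close>.
\<close>
definition binom_weight :: "nat \<Rightarrow> nat \<Rightarrow> real" where
  "binom_weight N l = (\<Prod>i<l. (real N - real i) / (real N + real i + 1))"

lemma binom_weight_0 [simp]: "binom_weight N 0 = 1"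
  by (simp add: binom_weight_def)

lemma binom_weight_eq_0: "N < l \<Longrightarrow> binom_weight N l = 0"
  by (auto simp: binom_weight_def)

lemma binom_weight_nonneg: "0 \<le> binom_weight N l"
proof (cases "l \<le> N")
  case True
  then show ?thesis
    unfolding binom_weight_def by (intro prod_nonneg) auto
qed (simp add: binom_weight_eq_0)

lemma binom_weight_le_1: "binom_weight N l \<le> 1"
proof (cases "l \<le> N")
  case True
  then show ?thesis
    unfolding binom_weight_def by (intro prod_le_1) auto
qed (simp add: binom_weight_eq_0)

lemma binom_weight_tendsto_1: "(\<lambda>N. binom_weight N l) \<longlonglongrightarrow> 1"
proof -
  have "(\<lambda>N. (real N - real i) / (real N + real i + 1)) \<longlonglongrightarrow> 1" for i
    by real_asymp
  then have "(\<lambda>N. binom_weight N l) \<longlonglongrightarrow> (\<Prod>i<l. 1)"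
    unfolding binom_weight_def by (intro tendsto_prod)
  then show ?thesis by simp
qed

lemma binom_weight_Suc_right:
  "(real N + real l + 1) * binom_weight N (Suc l) = (real N - real l) * binom_weight N l"
proof -
  have "real N + real l + 1 \<noteq> 0" by linarith
  then show ?thesis by (simp add: binom_weight_def)
qed

text \<open>The ratio of neighbouring weights in \<open>N\<close>, cleared of denominators so that
  it covers \<open>l = N + 1\<close>, where both sides vanish. Induction on \<open>l\<close> uses
  the recurrence in \<open>l\<close> at \<open>N\<close> and at \<open>N + 1\<close>.\<close>

lemma binom_weight_Suc_left:
  "binom_weight (Suc N) l * ((real N + 1)\<^sup>2 - (real l)\<^sup>2) = (real N + 1)\<^sup>2 * binom_weight N l"
proof (induction l)
  case (Suc l)
  let ?c = "binom_weight (Suc N)" and ?d = "binom_weight N"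
  let ?N = "real N" and ?l = "real l"
  have c: "(?N + ?l + 2) * ?c (Suc l) = (?N + 1 - ?l) * ?c l"
    using binom_weight_Suc_right[of "Suc N" l] by (simp add: algebra_simps)
  \<comment> \<open>The extra factor prepares the recurrence for \<open>?d\<close>; the one for
    \<open>?c\<close> applies because
    \<open>(N + 1)^2 - (l + 1)^2 = (N - l) (N + l + 2)\<close>.\<close>
  have "(?N + ?l + 1) * (?c (Suc l) * ((?N + 1)\<^sup>2 - (?l + 1)\<^sup>2))
      = (?N + ?l + 1) * (?N - ?l) * ((?N + ?l + 2) * ?c (Suc l))"
    by algebra
  also have "\<dots> = (?N - ?l) * (?c l * ((?N + 1)\<^sup>2 - ?l\<^sup>2))"
    unfolding c by algebra
  also have "\<dots> = (?N + 1)\<^sup>2 * ((?N - ?l) * ?d l)"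
    unfolding Suc.IH by simp
  also have "\<dots> = (?N + ?l + 1) * ((?N + 1)\<^sup>2 * ?d (Suc l))"
    unfolding binom_weight_Suc_right[symmetric] by simp
  finally have "?c (Suc l) * ((?N + 1)\<^sup>2 - (?l + 1)\<^sup>2) = (?N + 1)\<^sup>2 * ?d (Suc l)"
    by (subst (asm) mult_left_cancel) linarith+
  then show ?case by (simp add: add.commute)
qed simp

lemma alternating_sum_binom_weight:
  assumes "1 \<le> N"
  shows "(\<Sum>l=1..N. binom_weight N l * (- 2 * (-1) ^ l)) = 1"
proof -
  let ?d = "\<lambda>l. (-1) ^ l * binom_weight N l"
  \<comment> \<open>The recurrence in \<open>l\<close> turns each summand, times \<open>N\<close>,
    into \<open>l * ?d l - (l + 1) * ?d (l + 1)\<close>, which telescopes.\<close>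
  have "real N * (\<Sum>l<L. ?d l + ?d (Suc l)) = - (real L * ?d L)" for L
  proof (induction L)
    case (Suc L)
    have "real N * (?d L + ?d (Suc L)) = real L * ?d L - real (Suc L) * ?d (Suc L)"
      using arg_cong[OF binom_weight_Suc_right[of N L], of "\<lambda>x. (-1) ^ L * x"]
      by (simp add: algebra_simps)
    with Suc show ?case by (simp add: distrib_left)
  qed simp
  \<comment> \<open>At \<open>L = N + 1\<close> the boundary term vanishes and
    \<open>N \<ge> 1\<close> can be cancelled. The sum and its shift differ only by
    \<open>?d 0 = 1\<close>, so 1 plus twice the sum from 1 is 0.\<close>
  from this[of "Suc N"] assms have "(\<Sum>l<Suc N. ?d l + ?d (Suc l)) = 0"
    by (simp add: binom_weight_eq_0 del: sum.lessThan_Suc)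
  then have "(\<Sum>l<Suc N. ?d l) + (\<Sum>l<Suc N. ?d (Suc l)) = 0"
    by (simp only: sum.distrib)
  moreover have "(\<Sum>l<Suc N. ?d l) = 1 + (\<Sum>l=1..N. ?d l)"
    by (simp only: lessThan_Suc_atMost atMost_atLeast0 sum.atLeast_Suc_atMost) simp
  moreover have "(\<Sum>l<Suc N. ?d (Suc l)) = (\<Sum>l=1..N. ?d l)"
    by (simp add: binom_weight_eq_0 sum.atLeast1_atMost_eq)
  moreover have "(\<Sum>l=1..N. binom_weight N l * (- 2 * (-1) ^ l)) = - 2 * (\<Sum>l=1..N. ?d l)"
    by (simp add: sum_distrib_left mult_ac sum_negf)
  ultimately show ?thesis by simp
qed

text \<open>For fixed \<open>l \<ge> 1\<close>, \<open>binom_weight M l / M^2\<close> is the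
  increment in \<open>M\<close> of \<open>binom_weight M l / l^2\<close>, so the sum over
  \<open>M\<close> telescopes.\<close>

lemma sum_binom_weight_inverse_square:
  "(\<Sum>M=1..N. (\<Sum>l=1..M. binom_weight M l * g l) / (real M)\<^sup>2)
     = (\<Sum>l=1..N. binom_weight N l * (g l / (real l)\<^sup>2))"
proof (induction N)
  case (Suc N)
  have "binom_weight (Suc N) l * (g l / (real l)\<^sup>2) - binom_weight N l * (g l / (real l)\<^sup>2)
      = binom_weight (Suc N) l * g l / (real (Suc N))\<^sup>2" if "1 \<le> l" for l
  proof -
    have "(real N + 1)\<^sup>2 * (binom_weight (Suc N) l - binom_weight N l)
        = (real l)\<^sup>2 * binom_weight (Suc N) l"
      using binom_weight_Suc_left[of N l] by (simp add: algebra_simps)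
    then have "binom_weight (Suc N) l - binom_weight N l
        = (real l)\<^sup>2 * binom_weight (Suc N) l / (real N + 1)\<^sup>2"
      by (simp add: eq_divide_eq mult.commute)
    then have "(binom_weight (Suc N) l - binom_weight N l) * (g l / (real l)\<^sup>2)
        = binom_weight (Suc N) l * g l / (real N + 1)\<^sup>2"
      using that by simp
    then show ?thesis by (simp add: left_diff_distrib diff_divide_distrib add.commute)
  qed
  then have "(\<Sum>l=1..Suc N. binom_weight (Suc N) l * (g l / (real l)\<^sup>2))
      - (\<Sum>l=1..Suc N. binom_weight N l * (g l / (real l)\<^sup>2))
      = (\<Sum>l=1..Suc N. binom_weight (Suc N) l * g l) / (real (Suc N))\<^sup>2"
    unfolding sum_subtractf[symmetric] sum_divide_distrib by (intro sum.cong) auto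
  \<comment> \<open>The term \<open>l = N + 1\<close> of the subtracted sum is 0, which leaves the
    sum of the induction hypothesis.\<close>
  with Suc show ?case by (simp add: binom_weight_eq_0)
qed simp

lemma sum_binom_weight_difference:
  assumes "P 0 = 0"
  shows "real N * (\<Sum>l=1..N. binom_weight N l * (P l - P (l - 1)))
    = (\<Sum>l=1..N. binom_weight N l * (real l * (P l + P (l - 1))))"
proof -
  \<comment> \<open>Summation by parts: \<open>P 0 = 0\<close> removes the lower boundary term, and
    the upper one vanishes at \<open>L = N\<close>.\<close>
  have "real N * (\<Sum>l=1..L. binom_weight N l * (P l - P (l - 1)))
      - (\<Sum>l=1..L. binom_weight N l * (real l * (P l + P (l - 1))))
      = P L * ((real N - real L) * binom_weight N L)" for L
  proof (induction L)
    case (Suc L)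
    from Suc[folded binom_weight_Suc_right] show ?case
      by (simp add: algebra_simps)
  qed (simp add: assms)
  from this[of N] show ?thesis by simp
qed

section \<open>Appending the exponents\<close>

lemma zeta_star_upto_snoc_2:
  assumes "\<And>M. 1 \<le> M \<Longrightarrow> zeta_star_upto M ks = (\<Sum>l=1..M. binom_weight M l * g l)"
  shows "zeta_star_upto N (ks @ [2]) = (\<Sum>l=1..N. binom_weight N l * (g l / (real l)\<^sup>2))"
  unfolding sum_binom_weight_inverse_square[symmetric] zeta_star_upto_snoc
  by (intro sum.cong) (auto simp: assms)

text \<open>Of the factor \<open>1 / M^3\<close>, one \<open>1 / M\<close> is absorbed by passing
  from sums to differences of \<open>P\<close>; the remaining \<open>1 / M^2\<close> acts as an
  appended 2.\<close>

lemma zeta_star_upto_snoc_3: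
  assumes "P 0 = 0"
    and "\<And>M. 1 \<le> M \<Longrightarrow> zeta_star_upto M ks
          = (\<Sum>l=1..M. binom_weight M l * (real l * (P l + P (l - 1))))"
  shows "zeta_star_upto N (ks @ [3])
    = (\<Sum>l=1..N. binom_weight N l * ((P l - P (l - 1)) / (real l)\<^sup>2))"
proof -
  have "zeta_star_upto M ks / real M ^ 3
      = (\<Sum>l=1..M. binom_weight M l * (P l - P (l - 1))) / (real M)\<^sup>2" if "1 \<le> M" for M
    using that unfolding assms(2)[OF that] sum_binom_weight_difference[of P, OF assms(1), symmetric]
    by (simp add: power3_eq_cube power2_eq_square)
  then show ?thesis
    unfolding sum_binom_weight_inverse_square[symmetric] zeta_star_upto_snoc
    by (intro sum.cong) auto
qed

text \<open>The bound \<open>M \<ge> 1\<close> admits the empty list, whose truncated sum is 1 even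
  at \<open>M = 0\<close>, where the expansion gives 0.\<close>

lemma zeta_star_upto_append_2s:
  assumes "\<And>M. 1 \<le> M \<Longrightarrow> zeta_star_upto M ks = (\<Sum>l=1..M. binom_weight M l * g l)"
    and "1 \<le> N"
  shows "zeta_star_upto N (ks @ replicate n 2)
    = (\<Sum>l=1..N. binom_weight N l * (g l / real l ^ (2 * n)))"
  using assms(2)
proof (induction n arbitrary: N)
  case 0
  then show ?case by (simp add: assms(1))
next
  case (Suc n)
  have "ks @ replicate (Suc n) 2 = (ks @ replicate n 2) @ [2]"
    by (simp add: replicate_append_same)
  then have "zeta_star_upto N (ks @ replicate (Suc n) 2)
      = (\<Sum>l=1..N. binom_weight N l * (g l / real l ^ (2 * n) / (real l)\<^sup>2))"
    using zeta_star_upto_snoc_2[of "ks @ replicate n 2", OF Suc.IH] by simp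
  then show ?case by (simp add: power_add power2_eq_square mult_ac)
qed

lemma zeta_star_upto_2s_3_2s:
  fixes a b :: nat
  defines "P \<equiv> \<lambda>l. - 2 * (-1) ^ l * (\<Sum>j=1..l. 1 / real j ^ (2 * a + 1))"
  assumes "1 \<le> N"
  shows "zeta_star_upto N (replicate a 2 @ [3] @ replicate b 2)
    = (\<Sum>l=1..N. binom_weight N l * ((P l - P (l - 1)) / real l ^ (2 * b + 2)))"
proof -
  have P_add: "real l * (P l + P (l - 1)) = - 2 * (-1) ^ l / real l ^ (2 * a)" if "1 \<le> l" for l
  proof -
    obtain m where l: "l = Suc m"
      using \<open>1 \<le> l\<close> by (cases l) auto
    \<comment> \<open>The signs alternate, so only the last term of the inner sum survives.\<close>
    have "P l + P (l - 1) = - 2 * (-1) ^ l / real l ^ (2 * a + 1)"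
      unfolding l by (simp add: P_def distrib_left del: of_nat_Suc power_Suc) (simp add: sum_negf)
    then show ?thesis
      using that by simp
  qed
  have Nil: "zeta_star_upto M [] = (\<Sum>l=1..M. binom_weight M l * (- 2 * (-1) ^ l))"
    if "1 \<le> M" for M
    by (simp only: zeta_star_upto_Nil alternating_sum_binom_weight[OF that])
  have "zeta_star_upto M (replicate a 2)
      = (\<Sum>l=1..M. binom_weight M l * (real l * (P l + P (l - 1))))" if "1 \<le> M" for M
  proof -
    have "zeta_star_upto M (replicate a 2)
        = (\<Sum>l=1..M. binom_weight M l * (- 2 * (-1) ^ l / real l ^ (2 * a)))"
      using zeta_star_upto_append_2s[OF Nil that, of a] by simp
    also have "\<dots> = (\<Sum>l=1..M. binom_weight M l * (real l * (P l + P (l - 1))))"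
      by (intro sum.cong refl) (simp only: P_add atLeastAtMost_iff)
    finally show ?thesis .
  qed
  then have "zeta_star_upto M (replicate a 2 @ [3])
      = (\<Sum>l=1..M. binom_weight M l * ((P l - P (l - 1)) / (real l)\<^sup>2))" for M
    by (rule zeta_star_upto_snoc_3[rotated]) (simp_all add: P_def)
  from zeta_star_upto_append_2s[OF this assms(2), where n = b] show ?thesis
    by (simp add: power_add power2_eq_square mult_ac)
qed

section \<open>Passage to the limit\<close>

text \<open>A crude bound suffices: against \<open>1 / l^2\<close> it leaves the summable
  \<open>l powr (- 3 / 2)\<close>. It follows from
  \<open>1 / sqrt (n + 1) \<le> 2 * (sqrt (n + 1) - sqrt n)\<close>.\<close>

lemma harmonic_sum_le_sqrt: "(\<Sum>j=1..n. 1 / real j) \<le> 2 * sqrt (real n)"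
proof (induction n)
  case (Suc n)
  let ?s = "sqrt (real n)" and ?t = "sqrt (real (Suc n))"
  have t: "1 \<le> ?t" "?s \<le> ?t" by simp_all
  have "(?t - ?s) * (?t + ?s) = 1"
    by (simp add: algebra_simps)
  moreover have "(?t - ?s) * (?t + ?s) \<le> (?t - ?s) * (2 * ?t)"
    using t by (intro mult_left_mono) auto
  ultimately have "1 \<le> 2 * (?t - ?s) * ?t"
    by (simp only: mult_ac)
  then have "1 / ?t \<le> 2 * (?t - ?s)"
    by (subst pos_divide_le_eq) simp_all
  moreover have "1 / real (Suc n) \<le> 1 / ?t"
  proof (rule divide_left_mono)
    show "?t \<le> real (Suc n)" by (rule real_le_lsqrt) (simp_all add: power2_eq_square)
  qed auto
  ultimately show ?case using Suc by simp
qed simp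

lemma summable_alternating_power:
  assumes "2 \<le> k"
  shows "summable (\<lambda>l. \<bar>(-1) ^ l / real l ^ k\<bar>)"
  using inverse_power_summable[OF assms, where 'a = real]
  by (simp add: power_abs abs_mult divide_inverse)

lemma summable_alternating_double:
  assumes "1 \<le> r" "2 \<le> s"
  shows "summable (\<lambda>l. \<bar>(-1) ^ l / real l ^ s * (\<Sum>j=1..l - 1. 1 / real j ^ r)\<bar>)"
proof (rule summable_comparison_test)
  show "summable (\<lambda>l. 2 * real l powr (- 3 / 2))"
    by (intro summable_mult) (simp add: summable_real_powr_iff)
  have "norm \<bar>(-1) ^ l / real l ^ s * (\<Sum>j=1..l - 1. 1 / real j ^ r)\<bar> \<le> 2 * real l powr (- 3 / 2)"
    if "1 \<le> l" for l
  proof -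
    have "(\<Sum>j=1..l - 1. 1 / real j ^ r) \<le> (\<Sum>j=1..l - 1. 1 / real j)"
      using assms(1) by (intro sum_mono divide_left_mono self_le_power) auto
    also have "\<dots> \<le> 2 * sqrt (real (l - 1))"
      by (rule harmonic_sum_le_sqrt)
    also have "\<dots> \<le> 2 * sqrt (real l)" by simp
    finally have h: "(\<Sum>j=1..l - 1. 1 / real j ^ r) \<le> 2 * sqrt (real l)" .
    have "1 / real l ^ s \<le> 1 / real l ^ 2"
      using that assms(2) by (intro divide_left_mono power_increasing) auto
    then have "1 / real l ^ s * (\<Sum>j=1..l - 1. 1 / real j ^ r)
        \<le> 1 / real l ^ 2 * (2 * sqrt (real l))"
      using h by (intro mult_mono) (auto intro: sum_nonneg)
    also have "\<dots> = 2 * real l powr (- 3 / 2)"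
      using that powr_diff[of "real l" "1 / 2" 2] by (simp add: powr_half_sqrt powr_numeral)
    finally show ?thesis
      by (simp add: abs_mult power_abs sum_nonneg)
  qed
  then show "\<exists>N. \<forall>l\<ge>N. norm \<bar>(-1) ^ l / real l ^ s * (\<Sum>j=1..l - 1. 1 / real j ^ r)\<bar>
      \<le> 2 * real l powr (- 3 / 2)" by blast
qed

text \<open>The term at \<open>l = 0\<close> is 0, since division by zero yields 0.\<close>

lemma zeta_bar_eq:
  assumes "2 \<le> k"
  shows "(\<Sum>l. (-1) ^ l / real l ^ k) = zeta_bar k"
  using suminf_split_initial_segment[of "\<lambda>l. (-1) ^ l / real l ^ k" 1]
    summable_rabs_cancel[OF summable_alternating_power[OF assms]] assms
  by (simp add: zeta_bar_def)

text \<open>The inner sum is empty at \<open>l = 0\<close> and \<open>l = 1\<close>, hence the shift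
  by 2.\<close>

lemma zeta_bar2_eq:
  assumes "1 \<le> r" "2 \<le> s"
  shows "(\<Sum>l. (-1) ^ l / real l ^ s * (\<Sum>j=1..l - 1. 1 / real j ^ r)) = zeta_bar2 r s"
  using suminf_split_initial_segment[of
      "\<lambda>l. (-1) ^ l / real l ^ s * (\<Sum>j=1..l - 1. 1 / real j ^ r)" 2]
    summable_rabs_cancel[OF summable_alternating_double[OF assms]] assms
  by (simp add: zeta_bar2_def numeral_2_eq_2)

lemma sum_binom_weight_tendsto:
  assumes "summable (\<lambda>l. \<bar>f l\<bar>)" "f 0 = 0"
  shows "(\<lambda>N. \<Sum>l=1..N. binom_weight N l * f l) \<longlonglongrightarrow> (\<Sum>l. f l)"
proof -
  have "(\<lambda>N. \<Sum>l. binom_weight N l * f l) \<longlonglongrightarrow> (\<Sum>l. f l)"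
  proof (rule tannerys_theorem[THEN conjunct2, THEN conjunct2])
    show "(\<lambda>N. binom_weight N l * f l) \<longlonglongrightarrow> f l" for l
      using tendsto_mult[OF binom_weight_tendsto_1 tendsto_const, of l "f l"] by simp
    show "\<forall>\<^sub>F (l, N) in at_top \<times>\<^sub>F sequentially. norm (binom_weight N l * f l) \<le> \<bar>f l\<bar>"
      by (intro always_eventually)
        (auto simp: abs_mult binom_weight_nonneg binom_weight_le_1 intro: mult_left_le_one_le)
  qed (use assms in auto)
  moreover have "(\<Sum>l. binom_weight N l * f l) = (\<Sum>l=1..N. binom_weight N l * f l)" for N
    using assms(2) by (intro suminf_finite) (auto simp: binom_weight_eq_0 not_le Suc_le_eq)
  ultimately show ?thesis by simp
qed

theorem theorem1p2:
  fixes a b :: nat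
  shows "H_star a b = - 4 * zeta_bar2 (2 * a + 1) (2 * b + 2) - 2 * zeta_bar (2 * a + 2 * b + 3)"
proof -
  define P where "P = (\<lambda>l. - 2 * (-1) ^ l * (\<Sum>j=1..l. 1 / real j ^ (2 * a + 1)))"
  define f where "f = (\<lambda>l. (P l - P (l - 1)) / real l ^ (2 * b + 2))"
  define A where "A = (\<lambda>l. (-1) ^ l / real l ^ (2 * b + 2) * (\<Sum>j=1..l - 1. 1 / real j ^ (2 * a + 1)))"
  define B where "B = (\<lambda>l. (-1) ^ l / real l ^ (2 * a + 2 * b + 3))"
  have f_eq: "f l = - 4 * A l - 2 * B l" for l
  proof (cases l)
    case (Suc m)
    \<comment> \<open>Here the signs make the two inner sums add up: the common part counts twice,
      giving -4, and the last term once, giving -2.\<close>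
    have P_diff: "P l - P (l - 1) = - 4 * (-1) ^ l * (\<Sum>j=1..l - 1. 1 / real j ^ (2 * a + 1))
        - 2 * (-1) ^ l / real l ^ (2 * a + 1)"
      by (simp add: P_def Suc algebra_simps)
    have "real l ^ (2 * a + 2 * b + 3) = real l ^ (2 * a + 1) * real l ^ (2 * b + 2)"
      unfolding power_add[symmetric] by (rule arg_cong) simp
    then show ?thesis
      unfolding f_def A_def B_def P_diff by (simp add: diff_divide_distrib)
  qed (simp add: f_def A_def B_def)
  have A: "summable (\<lambda>l. \<bar>A l\<bar>)" and B: "summable (\<lambda>l. \<bar>B l\<bar>)"
    unfolding A_def B_def
    by (rule summable_alternating_double summable_alternating_power; simp)+
  have "summable (\<lambda>l. \<bar>f l\<bar>)"
  proof (rule summable_comparison_test)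
    show "summable (\<lambda>l. 4 * \<bar>A l\<bar> + 2 * \<bar>B l\<bar>)"
      using A B by (intro summable_add summable_mult)
    have "norm \<bar>f l\<bar> \<le> 4 * \<bar>A l\<bar> + 2 * \<bar>B l\<bar>" for l
      unfolding f_eq by simp
    then show "\<exists>N. \<forall>l\<ge>N. norm \<bar>f l\<bar> \<le> 4 * \<bar>A l\<bar> + 2 * \<bar>B l\<bar>" by blast
  qed
  then have "(\<lambda>N. \<Sum>l=1..N. binom_weight N l * f l) \<longlonglongrightarrow> (\<Sum>l. f l)"
    by (rule sum_binom_weight_tendsto) (simp add: f_def)
  \<comment> \<open>The expansion is available only for \<open>N \<ge> 1\<close>, so the sequences
    agree eventually.\<close>
  moreover have "\<forall>\<^sub>F N in sequentially. (\<Sum>l=1..N. binom_weight N l * f l)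
      = zeta_star_upto N (replicate a 2 @ [3] @ replicate b 2)"
    using eventually_ge_at_top[of 1]
    by eventually_elim (simp only: zeta_star_upto_2s_3_2s f_def P_def)
  ultimately have "H_star a b = (\<Sum>l. f l)"
    unfolding H_star_def by (intro zeta_star_eq_limit) (rule Lim_transform_eventually)
  also have "\<dots> = - 4 * (\<Sum>l. A l) - 2 * (\<Sum>l. B l)"
    unfolding f_eq using A[THEN summable_rabs_cancel] B[THEN summable_rabs_cancel]
    by (intro sums_unique[symmetric] sums_diff sums_mult summable_sums)
  also have "\<dots> = - 4 * zeta_bar2 (2 * a + 1) (2 * b + 2) - 2 * zeta_bar (2 * a + 2 * b + 3)"
    unfolding A_def B_def by (simp only: zeta_bar2_eq zeta_bar_eq le_add2)
  finally show ?thesis .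
qed

end
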